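(* In the setting below, if $\gamma$ is a proper and invertible generalizer, then: (1) $\overset{\simeq}{\gamma}$ is invertible; (2) $\mathrm{GCG}_{\simeq}(\Phi,\psi,\overset{\simeq}{\gamma})$ maintains Property 4 as an invariant.
   Context: LTS setting. A labeled transition system (LTS) is $\langle\Sigma,Q,Q_0,\Delta\rangle$ (finite labels $\Sigma$, finite states $Q$, initial states $Q_0\subseteq Q$, $\Delta\subseteq Q\times\Sigma\times Q$). Fix an LTS $M_0=\langle\Sigma,Q,Q_0,\Delta_0\rangle$; a completion of $M_0$ is an LTS with the same $\Sigma,Q,Q_0$ and transition relation $\Delta\supseteq\Delta_0$. Let $V=\{x_{p,a,q}: p,q\in Q, a\in\Sigma\}$; an assignment $\sigma:V\to\{0,1\}$ encodes the LTS $M_\sigma$ with $\Sigma,Q,Q_0$ and $\Delta_\sigma=\{(p,a,q):\sigma(x_{p,a,q})=1\}$. $\Phi$ is a propositional formula over $V$ that implies $\bigwedge_{(p,a,q)\in\Delta_0}x_{p,a,q}$. Let $A$ be the set of non-initial states of $M_0$ with no incoming or outgoing transitions in $\Delta_0$. For assignments $\sigma,\rho$ satisfying $\Phi$, $\sigma\simeq\rho$ means there is a bijection $f:Q\to Q$ with $f(q)=q$ for $q\notin A$ such that $(p,a,q)\in\Delta_\sigma$ iff $(f(p),a,f(q))\in\Delta_\rho$. For $\rho\models\Phi$, $[\rho]=\{\sigma:\sigma\models\Phi,\ \sigma\simeq\rho\}$, also viewed as the formula satisfied exactly by its elements. $\psi$ is a specification with satisfaction relation $M\models\psi$, assumed invariant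 under isomorphism: if $\sigma\simeq\rho$ then $M_\sigma\models\psi$ iff $M_\rho\models\psi$. A generalizer maps assignments to formulas over $V$; $\gamma$ is proper if for every $\sigma\models\Phi$ with $M_\sigma\not\models\psi$: $\sigma\models\gamma(\sigma)$, and no $\rho$ with $\rho\models\Phi$, $M_\rho\models\psi$ satisfies $\gamma(\sigma)$. For a generalizer $g$ and assignment $\tau$, $g^{-1}(\tau)$ is the formula satisfied exactly by those $\sigma$ with $\tau\models g(\sigma)$. A formula $\varphi$ subsumes $\varphi'$ up to isomorphism if for every $\sigma\models\varphi$ there is $\sigma'\models\varphi'$ with $\sigma'\simeq\sigma$; they are equivalent up to isomorphism if each subsumes the other. $g$ is invertible if for all $\tau,\tau'$ satisfying $\Phi$ with $\tau\simeq\tau'$, $g^{-1}(\tau)$ and $g^{-1}(\tau')$ are equivalent up to isomorphism. The equivalence closure of $\gamma$ is $\overset{\simeq}{\gamma}(\rho):=\bigvee_{\sigma\in[\rho]}\gamma(\sigma)$. Algorithm $\mathrm{GCG}_{\simeq}(\Phi,\psi,g)$: keep $\Phi_{cur}:=\Phi$; while $\Phi_{cur}$ is satisfiable, pick an arbitrary $\sigma\models\Phi_{cur}$; if $M_\sigma\models\psi$, output $\sigma$ (a solution) and set $\Phi_{cur}:=\Phi_{cur}\wedge\neg[\sigma]$; else set $\Phi_{cur}:=\Phi_{cur}\wedge\neg g(\sigma)$. In an execution, $\mathsf{Sol}$ is the set of solutions output so far and $\mathsf{Pruned}$ is the set of all assignments satisfying some formula $\varphi$ for which a step $\Phi_{cur}:=\Phi_{cur}\wedge\neg\varphi$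 has been performed so far. Property 4 (invariant): in every execution, at every point, for all $\tau,\tau'$ satisfying $\Phi$ with $\tau\in\mathsf{Pruned}$ and $\tau'\simeq\tau$, we have $\tau'\in\mathsf{Pruned}$ or $\tau'\in\mathsf{Sol}$. *)

theory Defs
  imports Main "HOL-Library.FuncSet"
begin

section \<open>Labeled transition systems\<close>

record ('a, 'q) lts =
  labels :: "'a set"
  states :: "'q set"
  inits :: "'q set"
  transitions :: "('q \<times> 'a \<times> 'q) set"

definition wf_lts :: "('a, 'q) lts \<Rightarrow> bool" where
  "wf_lts M \<longleftrightarrow> finite (labels M) \<and> finite (states M) \<and> inits M \<subseteq> states M \<and>
     transitions M \<subseteq> states M \<times> labels M \<times> states M"

definition isolated_states :: "('a, 'q) lts \<Rightarrow> 'q set" where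
  "isolated_states M = {q \<in> states M - inits M.
     \<forall>p a. (p, a, q) \<notin> transitions M \<and> (q, a, p) \<notin> transitions M}"


section \<open>Propositional formulas\<close>

datatype (atoms: 'v) form =
    Bot
  | Atom 'v
  | Neg "'v form"
  | Conj "'v form" "'v form"
  | Disj "'v form" "'v form"

primrec sat :: "('v \<Rightarrow> bool) \<Rightarrow> 'v form \<Rightarrow> bool" where
  "sat \<sigma> Bot = False"
| "sat \<sigma> (Atom v) = \<sigma> v"
| "sat \<sigma> (Neg \<phi>) = (\<not> sat \<sigma> \<phi>)"
| "sat \<sigma> (Conj \<phi> \<chi>) = (sat \<sigma> \<phi> \<and> sat \<sigma> \<chi>)"
| "sat \<sigma> (Disj \<phi> \<chi>) = (sat \<sigma> \<phi> \<or> sat \<sigma> \<chi>)"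

text \<open>The disjunction of a finite set of formulas, taken in some order.\<close>

definition Big_Disj :: "'v form set \<Rightarrow> 'v form" where
  "Big_Disj F = foldr Disj (SOME xs. set xs = F) Bot"

lemma Big_Disj_props:
  fixes F :: "'v form set"
  assumes "finite F"
  shows sat_Big_Disj: "sat \<sigma> (Big_Disj F) \<longleftrightarrow> (\<exists>\<phi>\<in>F. sat \<sigma> \<phi>)"
    and atoms_Big_Disj: "atoms (Big_Disj F) = (\<Union>\<phi>\<in>F. atoms \<phi>)"
proof -
  have *: "set (SOME xs. set xs = F) = F"
    using finite_list[OF assms] by (rule someI_ex)
  have 1: "sat \<sigma> (foldr Disj xs Bot) \<longleftrightarrow> (\<exists>\<phi>\<in>set xs. sat \<sigma> \<phi>)" for xs :: "'v form list"
    by (induction xs) auto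
  have 2: "atoms (foldr Disj xs Bot) = (\<Union>\<phi>\<in>set xs. atoms \<phi>)" for xs :: "'v form list"
    by (induction xs) auto
  show "sat \<sigma> (Big_Disj F) \<longleftrightarrow> (\<exists>\<phi>\<in>F. sat \<sigma> \<phi>)"
    unfolding Big_Disj_def 1 * ..
  show "atoms (Big_Disj F) = (\<Union>\<phi>\<in>F. atoms \<phi>)"
    unfolding Big_Disj_def 2 * ..
qed

text \<open>
  A formula over \<open>V\<close> whose satisfying assignments are exactly the elements of \<open>S\<close>; for finite \<open>V\<close>
  it exists and is unique up to logical equivalence.
\<close>

definition formula_of :: "'v set \<Rightarrow> ('v \<Rightarrow> bool) set \<Rightarrow> 'v form" where
  "formula_of V S = (SOME \<phi>. atoms \<phi> \<subseteq> V \<and> (\<forall>\<sigma> \<in> V \<rightarrow>\<^sub>E UNIV. sat \<sigma> \<phi> \<longleftrightarrow> \<sigma> \<in> S))"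

lemma formula_of_props:
  fixes V :: "'v set"
  assumes "finite V"
  shows atoms_formula_of: "atoms (formula_of V S) \<subseteq> V"
    and sat_formula_of: "\<sigma> \<in> V \<rightarrow>\<^sub>E UNIV \<Longrightarrow> sat \<sigma> (formula_of V S) \<longleftrightarrow> \<sigma> \<in> S"
proof -
  define cube where
    "cube \<rho> = Neg (Big_Disj ((\<lambda>v. if \<rho> v then Neg (Atom v) else Atom v) ` V))" for \<rho> :: "'v \<Rightarrow> bool"
  have atoms_cube: "atoms (cube \<rho>) \<subseteq> V" for \<rho>
    using assms by (auto simp: cube_def atoms_Big_Disj split: if_splits)
  have sat_cube: "sat \<tau> (cube \<rho>) \<longleftrightarrow> \<tau> = \<rho>" if "\<tau> \<in> V \<rightarrow>\<^sub>E UNIV" "\<rho> \<in> V \<rightarrow>\<^sub>E UNIV" for \<tau> \<rho>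
  proof -
    have "sat \<tau> (cube \<rho>) \<longleftrightarrow> (\<forall>v\<in>V. \<tau> v = \<rho> v)"
      using assms by (auto simp: cube_def sat_Big_Disj simp del: if_image_distrib split: if_splits)
    then show ?thesis using that by (auto intro: PiE_ext)
  qed
  let ?A = "(V \<rightarrow>\<^sub>E UNIV) \<inter> S"
  have fin: "finite (cube ` ?A)"
    using assms by (intro finite_imageI finite_Int disjI1 finite_PiE) auto
  have "\<exists>\<phi>. atoms \<phi> \<subseteq> V \<and> (\<forall>\<sigma> \<in> V \<rightarrow>\<^sub>E UNIV. sat \<sigma> \<phi> \<longleftrightarrow> \<sigma> \<in> S)"
    using atoms_cube sat_cube
    by (intro exI[of _ "Big_Disj (cube ` ?A)"]) (auto simp: sat_Big_Disj[OF fin] atoms_Big_Disj[OF fin])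
  from someI_ex[OF this]
  show "atoms (formula_of V S) \<subseteq> V"
    and "\<sigma> \<in> V \<rightarrow>\<^sub>E UNIV \<Longrightarrow> sat \<sigma> (formula_of V S) \<longleftrightarrow> \<sigma> \<in> S"
    by (auto simp: formula_of_def)
qed


section \<open>Assignments, encoded systems and isomorphism\<close>

text \<open>
  The triple \<open>(p, a, q)\<close> serves as the variable \<open>x\<^bsub>p,a,q\<^esub>\<close>. In what follows \<open>M\<close> is the fixed
  system that is to be completed.
\<close>

definition variables :: "('a, 'q) lts \<Rightarrow> ('q \<times> 'a \<times> 'q) set" where
  "variables M = states M \<times> labels M \<times> states M"

definition assignments :: "('a, 'q) lts \<Rightarrow> ('q \<times> 'a \<times> 'q \<Rightarrow> bool) set" where
  "assignments M = variables M \<rightarrow>\<^sub>E UNIV"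

definition models :: "('a, 'q) lts \<Rightarrow> ('q \<times> 'a \<times> 'q) form \<Rightarrow> ('q \<times> 'a \<times> 'q \<Rightarrow> bool) set" where
  "models M \<phi> = {\<sigma> \<in> assignments M. sat \<sigma> \<phi>}"

definition lts_of :: "('a, 'q) lts \<Rightarrow> ('q \<times> 'a \<times> 'q \<Rightarrow> bool) \<Rightarrow> ('a, 'q) lts" where
  "lts_of M \<sigma> = M\<lparr>transitions := {t \<in> variables M. \<sigma> t}\<rparr>"

definition isomorphic ::
  "('a, 'q) lts \<Rightarrow> ('q \<times> 'a \<times> 'q) form \<Rightarrow>
   ('q \<times> 'a \<times> 'q \<Rightarrow> bool) \<Rightarrow> ('q \<times> 'a \<times> 'q \<Rightarrow> bool) \<Rightarrow> bool" where
  "isomorphic M \<Phi> \<sigma> \<rho> \<longleftrightarrow> \<sigma> \<in> models M \<Phi> \<and> \<rho> \<in> models M \<Phi> \<and>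
     (\<exists>f. bij_betw f (states M) (states M) \<and>
          (\<forall>q \<in> states M - isolated_states M. f q = q) \<and>
          (\<forall>p \<in> states M. \<forall>a \<in> labels M. \<forall>q \<in> states M.
             (p, a, q) \<in> transitions (lts_of M \<sigma>) \<longleftrightarrow> (f p, a, f q) \<in> transitions (lts_of M \<rho>)))"

definition iso_class ::
  "('a, 'q) lts \<Rightarrow> ('q \<times> 'a \<times> 'q) form \<Rightarrow>
   ('q \<times> 'a \<times> 'q \<Rightarrow> bool) \<Rightarrow> ('q \<times> 'a \<times> 'q \<Rightarrow> bool) set" where
  "iso_class M \<Phi> \<rho> = {\<sigma> \<in> models M \<Phi>. isomorphic M \<Phi> \<sigma> \<rho>}"

definition iso_class_formula ::
  "('a, 'q) lts \<Rightarrow> ('q \<times> 'a \<times> 'q) form \<Rightarrow>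
   ('q \<times> 'a \<times> 'q \<Rightarrow> bool) \<Rightarrow> ('q \<times> 'a \<times> 'q) form" where
  "iso_class_formula M \<Phi> \<rho> = formula_of (variables M) (iso_class M \<Phi> \<rho>)"


section \<open>Generalizers\<close>

type_synonym ('a, 'q) gen = "('q \<times> 'a \<times> 'q \<Rightarrow> bool) \<Rightarrow> ('q \<times> 'a \<times> 'q) form"

definition generalizer :: "('a, 'q) lts \<Rightarrow> ('a, 'q) gen \<Rightarrow> bool" where
  "generalizer M g \<longleftrightarrow> (\<forall>\<sigma> \<in> assignments M. atoms (g \<sigma>) \<subseteq> variables M)"

definition proper ::
  "('a, 'q) lts \<Rightarrow> ('q \<times> 'a \<times> 'q) form \<Rightarrow> (('a, 'q) lts \<Rightarrow> 'spec \<Rightarrow> bool) \<Rightarrow> 'spec \<Rightarrow>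
   ('a, 'q) gen \<Rightarrow> bool" where
  "proper M \<Phi> satisfies \<psi> g \<longleftrightarrow>
     (\<forall>\<sigma> \<in> models M \<Phi>. \<not> satisfies (lts_of M \<sigma>) \<psi> \<longrightarrow>
        \<sigma> \<in> models M (g \<sigma>) \<and>
        \<not> (\<exists>\<rho> \<in> models M \<Phi>. satisfies (lts_of M \<rho>) \<psi> \<and> \<rho> \<in> models M (g \<sigma>)))"

definition gen_inverse ::
  "('a, 'q) lts \<Rightarrow> ('a, 'q) gen \<Rightarrow> ('q \<times> 'a \<times> 'q \<Rightarrow> bool) \<Rightarrow> ('q \<times> 'a \<times> 'q) form" where
  "gen_inverse M g \<tau> = formula_of (variables M) {\<sigma> \<in> assignments M. \<tau> \<in> models M (g \<sigma>)}"

text \<open>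
  Isomorphism is only defined between assignments satisfying \<open>\<Phi>\<close>, so formulas are compared on these
  assignments. Without the conjunct \<open>\<sigma> \<in> models M \<Phi>\<close>, the arbitrary values of a generalizer outside
  \<open>\<Phi>\<close> would already decide whether it is invertible.
\<close>

definition subsumes ::
  "('a, 'q) lts \<Rightarrow> ('q \<times> 'a \<times> 'q) form \<Rightarrow>
   ('q \<times> 'a \<times> 'q) form \<Rightarrow> ('q \<times> 'a \<times> 'q) form \<Rightarrow> bool" where
  "subsumes M \<Phi> \<phi> \<phi>' \<longleftrightarrow>
     (\<forall>\<sigma>. \<sigma> \<in> models M \<Phi> \<and> \<sigma> \<in> models M \<phi> \<longrightarrow> (\<exists>\<sigma>' \<in> models M \<phi>'. isomorphic M \<Phi> \<sigma>' \<sigma>))"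

definition equivalent_upto_iso ::
  "('a, 'q) lts \<Rightarrow> ('q \<times> 'a \<times> 'q) form \<Rightarrow>
   ('q \<times> 'a \<times> 'q) form \<Rightarrow> ('q \<times> 'a \<times> 'q) form \<Rightarrow> bool" where
  "equivalent_upto_iso M \<Phi> \<phi> \<phi>' \<longleftrightarrow> subsumes M \<Phi> \<phi> \<phi>' \<and> subsumes M \<Phi> \<phi>' \<phi>"

definition invertible :: "('a, 'q) lts \<Rightarrow> ('q \<times> 'a \<times> 'q) form \<Rightarrow> ('a, 'q) gen \<Rightarrow> bool" where
  "invertible M \<Phi> g \<longleftrightarrow>
     (\<forall>\<tau> \<in> models M \<Phi>. \<forall>\<tau>' \<in> models M \<Phi>. isomorphic M \<Phi> \<tau> \<tau>' \<longrightarrow>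
        equivalent_upto_iso M \<Phi> (gen_inverse M g \<tau>) (gen_inverse M g \<tau>'))"

definition equiv_closure ::
  "('a, 'q) lts \<Rightarrow> ('q \<times> 'a \<times> 'q) form \<Rightarrow> ('a, 'q) gen \<Rightarrow> ('a, 'q) gen" where
  "equiv_closure M \<Phi> g \<rho> = Big_Disj (g ` iso_class M \<Phi> \<rho>)"


section \<open>The algorithm\<close>

record ('a, 'q) gcg_state =
  cur :: "('q \<times> 'a \<times> 'q) form"
  Sol :: "('q \<times> 'a \<times> 'q \<Rightarrow> bool) set"
  Pruned :: "('q \<times> 'a \<times> 'q \<Rightarrow> bool) set"

definition gcg_init :: "('q \<times> 'a \<times> 'q) form \<Rightarrow> ('a, 'q) gcg_state" where
  "gcg_init \<Phi> = \<lparr>cur = \<Phi>, Sol = {}, Pruned = {}\<rparr>"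

text \<open>One iteration of the loop; it is nondeterministic in the choice of \<open>\<sigma>\<close>.\<close>

inductive gcg_step ::
  "('a, 'q) lts \<Rightarrow> ('q \<times> 'a \<times> 'q) form \<Rightarrow> (('a, 'q) lts \<Rightarrow> 'spec \<Rightarrow> bool) \<Rightarrow> 'spec \<Rightarrow>
   ('a, 'q) gen \<Rightarrow> ('a, 'q) gcg_state \<Rightarrow> ('a, 'q) gcg_state \<Rightarrow> bool"
  for M \<Phi> satisfies \<psi> g where
  solution:
    "\<lbrakk>\<sigma> \<in> models M (cur s); satisfies (lts_of M \<sigma>) \<psi>; \<phi> = iso_class_formula M \<Phi> \<sigma>\<rbrakk> \<Longrightarrow>
     gcg_step M \<Phi> satisfies \<psi> g s
       \<lparr>cur = Conj (cur s) (Neg \<phi>), Sol = insert \<sigma> (Sol s), Pruned = Pruned s \<union> models M \<phi>\<rparr>"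
| counterexample:
    "\<lbrakk>\<sigma> \<in> models M (cur s); \<not> satisfies (lts_of M \<sigma>) \<psi>; \<phi> = g \<sigma>\<rbrakk> \<Longrightarrow>
     gcg_step M \<Phi> satisfies \<psi> g s
       \<lparr>cur = Conj (cur s) (Neg \<phi>), Sol = Sol s, Pruned = Pruned s \<union> models M \<phi>\<rparr>"

definition gcg_invariant ::
  "('a, 'q) lts \<Rightarrow> ('q \<times> 'a \<times> 'q) form \<Rightarrow> (('a, 'q) lts \<Rightarrow> 'spec \<Rightarrow> bool) \<Rightarrow> 'spec \<Rightarrow>
   ('a, 'q) gen \<Rightarrow> (('a, 'q) gcg_state \<Rightarrow> bool) \<Rightarrow> bool" where
  "gcg_invariant M \<Phi> satisfies \<psi> g I \<longleftrightarrow>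
     (\<forall>s. (gcg_step M \<Phi> satisfies \<psi> g)\<^sup>*\<^sup>* (gcg_init \<Phi>) s \<longrightarrow> I s)"

definition pruned_upto_iso ::
  "('a, 'q) lts \<Rightarrow> ('q \<times> 'a \<times> 'q) form \<Rightarrow> ('a, 'q) gcg_state \<Rightarrow> bool" where
  "pruned_upto_iso M \<Phi> s \<longleftrightarrow>
     (\<forall>\<tau> \<in> models M \<Phi>. \<forall>\<tau>' \<in> models M \<Phi>.
        \<tau> \<in> Pruned s \<and> isomorphic M \<Phi> \<tau>' \<tau> \<longrightarrow> \<tau>' \<in> Pruned s \<or> \<tau>' \<in> Sol s)"

end

theory Submission
  imports Defs
begin

text \<open>
  If \<open>\<tau> \<simeq> \<tau>'\<close> and \<open>\<tau>\<close> is generalized from some \<open>\<sigma>\<^sub>1 \<in> [\<sigma>]\<close>, then invertibility of \<open>\<gamma>\<close> yields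
  \<open>\<sigma>\<^sub>2 \<simeq> \<sigma>\<^sub>1\<close> from which \<open>\<tau>'\<close> is generalized, and \<open>\<sigma>\<^sub>2 \<in> [\<sigma>]\<close> again. Hence, among the models of \<open>\<Phi>\<close>,
  each formula produced by the closure is satisfied by a union of isomorphism classes. Both claims
  follow: inverse images under the closure agree on isomorphic assignments, and every pruning
  step removes whole isomorphism classes.
\<close>

lemma isomorphicD:
  assumes "isomorphic M \<Phi> \<sigma> \<rho>"
  shows "\<sigma> \<in> models M \<Phi>" "\<rho> \<in> models M \<Phi>"
  using assms by (auto simp: isomorphic_def)

text \<open>A bijection of \<open>states M\<close> sends variables to variables, so the membership
  test inside \<open>lts_of\<close> is true on both sides and isomorphism becomes a condition on the
  assignments alone.\<close>

lemma isomorphic_iff: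
  "isomorphic M \<Phi> \<sigma> \<rho> \<longleftrightarrow> \<sigma> \<in> models M \<Phi> \<and> \<rho> \<in> models M \<Phi> \<and>
     (\<exists>f. bij_betw f (states M) (states M) \<and>
          (\<forall>q \<in> states M - isolated_states M. f q = q) \<and>
          (\<forall>p \<in> states M. \<forall>a \<in> labels M. \<forall>q \<in> states M. \<sigma> (p, a, q) \<longleftrightarrow> \<rho> (f p, a, f q)))"
  unfolding isomorphic_def lts_of_def variables_def
  by (intro conj_cong refl ex_cong1) (auto dest: bij_betw_apply)

lemma isomorphic_refl: "\<sigma> \<in> models M \<Phi> \<Longrightarrow> isomorphic M \<Phi> \<sigma> \<sigma>"
  unfolding isomorphic_iff by (auto intro!: exI[of _ id])

lemma isomorphic_sym:
  assumes "isomorphic M \<Phi> \<sigma> \<rho>"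
  shows "isomorphic M \<Phi> \<rho> \<sigma>"
proof -
  from assms obtain f where f: "bij_betw f (states M) (states M)"
    "\<forall>q \<in> states M - isolated_states M. f q = q"
    "\<forall>p \<in> states M. \<forall>a \<in> labels M. \<forall>q \<in> states M. \<sigma> (p, a, q) \<longleftrightarrow> \<rho> (f p, a, f q)"
    by (auto simp: isomorphic_iff)
  let ?h = "inv_into (states M) f"
  have h: "bij_betw ?h (states M) (states M)"
    using f(1) by (rule bij_betw_inv_into)
  \<comment> \<open>A state fixed by \<open>f\<close> is its own unique preimage, hence also fixed
    by the inverse.\<close>
  moreover have "\<forall>q \<in> states M - isolated_states M. ?h q = q"
    using f(1,2) by (metis DiffD1 bij_betw_inv_into_left)
  moreover have "\<forall>p \<in> states M. \<forall>a \<in> labels M. \<forall>q \<in> states M. \<rho> (p, a, q) \<longleftrightarrow> \<sigma> (?h p, a, ?h q)"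
    using f(3) bij_betw_apply[OF h] bij_betw_inv_into_right[OF f(1)] by simp
  ultimately show ?thesis
    using isomorphicD[OF assms] by (auto simp: isomorphic_iff)
qed

lemma isomorphic_trans:
  assumes "isomorphic M \<Phi> \<sigma> \<rho>" and "isomorphic M \<Phi> \<rho> \<tau>"
  shows "isomorphic M \<Phi> \<sigma> \<tau>"
proof -
  from assms(1) obtain f where f: "bij_betw f (states M) (states M)"
    "\<forall>q \<in> states M - isolated_states M. f q = q"
    "\<forall>p \<in> states M. \<forall>a \<in> labels M. \<forall>q \<in> states M. \<sigma> (p, a, q) \<longleftrightarrow> \<rho> (f p, a, f q)"
    by (auto simp: isomorphic_iff)
  from assms(2) obtain h where h: "bij_betw h (states M) (states M)"
    "\<forall>q \<in> states M - isolated_states M. h q = q"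
    "\<forall>p \<in> states M. \<forall>a \<in> labels M. \<forall>q \<in> states M. \<rho> (p, a, q) \<longleftrightarrow> \<tau> (h p, a, h q)"
    by (auto simp: isomorphic_iff)
  have "bij_betw (h \<circ> f) (states M) (states M)"
    using f(1) h(1) by (rule bij_betw_trans)
  moreover have "\<forall>q \<in> states M - isolated_states M. (h \<circ> f) q = q"
    using f(2) h(2) by simp
  moreover have "\<forall>p \<in> states M. \<forall>a \<in> labels M. \<forall>q \<in> states M.
      \<sigma> (p, a, q) \<longleftrightarrow> \<tau> ((h \<circ> f) p, a, (h \<circ> f) q)"
    using f(3) h(3) bij_betw_apply[OF f(1)] by simp
  ultimately show ?thesis
    using isomorphicD(1)[OF assms(1)] isomorphicD(2)[OF assms(2)]
    unfolding isomorphic_iff by blast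
qed

lemma finite_variables: "wf_lts M \<Longrightarrow> finite (variables M)"
  by (simp add: wf_lts_def variables_def)

lemma finite_iso_class:
  assumes "wf_lts M"
  shows "finite (iso_class M \<Phi> \<sigma>)"
proof (rule finite_subset)
  show "iso_class M \<Phi> \<sigma> \<subseteq> assignments M"
    by (auto simp: iso_class_def models_def)
  show "finite (assignments M)"
    unfolding assignments_def using finite_variables[OF assms] by (intro finite_PiE) auto
qed

text \<open>Replaces the formula chosen in \<open>formula_of\<close> by its set of models, so that
  later arguments are purely semantic. The intersection appears because \<open>S\<close> may contain
  functions outside \<open>assignments M\<close>.\<close>

lemma models_formula_of:
  assumes "wf_lts M"
  shows "models M (formula_of (variables M) S) = assignments M \<inter> S"
  using sat_formula_of[OF finite_variables[OF assms]] by (auto simp: models_def assignments_def)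

lemma models_iso_class_formula:
  assumes "wf_lts M"
  shows "models M (iso_class_formula M \<Phi> \<sigma>) = iso_class M \<Phi> \<sigma>"
  unfolding iso_class_formula_def models_formula_of[OF assms]
  by (auto simp: iso_class_def models_def)

lemma models_gen_inverse:
  assumes "wf_lts M"
  shows "models M (gen_inverse M g \<tau>) = {\<sigma> \<in> assignments M. \<tau> \<in> models M (g \<sigma>)}"
  unfolding gen_inverse_def models_formula_of[OF assms] by auto

text \<open>Finiteness of the class matters here: only then does a list enumerating the disjuncts of
  \<open>Big_Disj\<close> exist.\<close>

lemma models_equiv_closure:
  assumes "wf_lts M"
  shows "models M (equiv_closure M \<Phi> g \<rho>) = (\<Union>\<sigma>\<in>iso_class M \<Phi> \<rho>. models M (g \<sigma>))"
  using finite_iso_class[OF assms] by (auto simp: equiv_closure_def models_def sat_Big_Disj)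

lemma models_equiv_closure_isomorphic:
  assumes wf: "wf_lts M" and inv: "invertible M \<Phi> g"
    and \<tau>: "\<tau> \<in> models M (equiv_closure M \<Phi> g \<sigma>)" and iso: "isomorphic M \<Phi> \<tau> \<tau>'"
  shows "\<tau>' \<in> models M (equiv_closure M \<Phi> g \<sigma>)"
proof -
  from \<tau> obtain \<sigma>1 where \<sigma>1: "isomorphic M \<Phi> \<sigma>1 \<sigma>" "\<tau> \<in> models M (g \<sigma>1)"
    by (auto simp: models_equiv_closure[OF wf] iso_class_def)
  \<comment> \<open>\<open>subsumes\<close> quantifies over models of \<Phi> only, so this is
    secured before invertibility is applied to \<open>\<sigma>1\<close>; it also provides the
    membership in \<open>assignments M\<close> that the inverse image demands.\<close>
  then have "\<sigma>1 \<in> models M \<Phi>"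
    using isomorphicD(1) by blast
  moreover from this \<sigma>1(2) have "\<sigma>1 \<in> models M (gen_inverse M g \<tau>)"
    unfolding models_gen_inverse[OF wf] by (simp add: models_def)
  moreover have "subsumes M \<Phi> (gen_inverse M g \<tau>) (gen_inverse M g \<tau>')"
    using inv iso isomorphicD[OF iso] by (auto simp: invertible_def equivalent_upto_iso_def)
  ultimately obtain \<sigma>2 where "isomorphic M \<Phi> \<sigma>2 \<sigma>1" "\<sigma>2 \<in> models M (gen_inverse M g \<tau>')"
    unfolding subsumes_def by blast
  then have "\<sigma>2 \<in> iso_class M \<Phi> \<sigma>" "\<tau>' \<in> models M (g \<sigma>2)"
    using \<sigma>1(1) by (auto simp: iso_class_def models_gen_inverse[OF wf]
        dest: isomorphicD(1) intro: isomorphic_trans)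
  then show ?thesis
    by (auto simp: models_equiv_closure[OF wf])
qed

lemma invertible_equiv_closure:
  assumes "wf_lts M" and "invertible M \<Phi> g"
  shows "invertible M \<Phi> (equiv_closure M \<Phi> g)"
proof -
  have "subsumes M \<Phi> (gen_inverse M (equiv_closure M \<Phi> g) \<tau>)
      (gen_inverse M (equiv_closure M \<Phi> g) \<tau>')" if "isomorphic M \<Phi> \<tau> \<tau>'" for \<tau> \<tau>'
    \<comment> \<open>The witness is the given assignment itself: if its closure formula holds at
      \<tau>, it holds at \<open>\<tau>'\<close> as well, and reflexivity supplies the
      isomorphism.\<close>
    unfolding subsumes_def models_gen_inverse[OF assms(1)]
    using models_equiv_closure_isomorphic[OF assms _ that] isomorphic_refl by blast
  then show ?thesis
    by (auto simp: invertible_def equivalent_upto_iso_def intro: isomorphic_sym)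
qed

lemma gcg_invariant_equiv_closure:
  assumes wf: "wf_lts M" and inv: "invertible M \<Phi> g"
  shows "gcg_invariant M \<Phi> satisfies \<psi> (equiv_closure M \<Phi> g) (pruned_upto_iso M \<Phi>)"
proof -
  \<comment> \<open>A stronger invariant carries the induction: \<open>Pruned\<close> by itself is
    closed under isomorphism. Whichever assignment is picked, a step adds either an isomorphism
    class or the models of a closure formula, and both sets are closed.\<close>
  have "\<forall>\<tau> \<tau>'. \<tau> \<in> Pruned s \<and> isomorphic M \<Phi> \<tau> \<tau>' \<longrightarrow> \<tau>' \<in> Pruned s"
    if "(gcg_step M \<Phi> satisfies \<psi> (equiv_closure M \<Phi> g))\<^sup>*\<^sup>* (gcg_init \<Phi>) s" for s
    using that
  proof (induction rule: rtranclp_induct)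
    case base
    then show ?case by (simp add: gcg_init_def)
  next
    case (step s t)
    from step.hyps(2) show ?case
    proof cases
      case (solution \<sigma> \<phi>)
      have "\<tau>' \<in> models M \<phi>" if "\<tau> \<in> models M \<phi>" "isomorphic M \<Phi> \<tau> \<tau>'" for \<tau> \<tau>'
        using that unfolding solution(4) models_iso_class_formula[OF wf] iso_class_def
        by (blast intro: isomorphic_trans isomorphic_sym isomorphicD)
      then show ?thesis using step.IH solution(1) by auto
    next
      case (counterexample \<sigma> \<phi>)
      then show ?thesis
        using step.IH models_equiv_closure_isomorphic[OF wf inv] by auto
    qed
  qed
  then show ?thesis
    by (auto simp: gcg_invariant_def pruned_upto_iso_def dest: isomorphic_sym)
qed

theorem theorem6:
  fixes M\<^sub>0 :: "('a, 'q) lts"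
    and \<Phi> :: "('q \<times> 'a \<times> 'q) form"
    and satisfies :: "('a, 'q) lts \<Rightarrow> 'spec \<Rightarrow> bool"
    and \<psi> :: 'spec
    and \<gamma> :: "('a, 'q) gen"
  assumes "wf_lts M\<^sub>0"
    and "atoms \<Phi> \<subseteq> variables M\<^sub>0"
    and "\<forall>\<sigma> \<in> models M\<^sub>0 \<Phi>. \<forall>t \<in> transitions M\<^sub>0. \<sigma> t"
    and "\<forall>\<sigma> \<rho>. isomorphic M\<^sub>0 \<Phi> \<sigma> \<rho> \<longrightarrow>
           (satisfies (lts_of M\<^sub>0 \<sigma>) \<psi> \<longleftrightarrow> satisfies (lts_of M\<^sub>0 \<rho>) \<psi>)"
    and "generalizer M\<^sub>0 \<gamma>"
    and "proper M\<^sub>0 \<Phi> satisfies \<psi> \<gamma>"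
    and "invertible M\<^sub>0 \<Phi> \<gamma>"
  shows "invertible M\<^sub>0 \<Phi> (equiv_closure M\<^sub>0 \<Phi> \<gamma>) \<and>
         gcg_invariant M\<^sub>0 \<Phi> satisfies \<psi> (equiv_closure M\<^sub>0 \<Phi> \<gamma>) (pruned_upto_iso M\<^sub>0 \<Phi>)"
  using assms(1,7) by (intro conjI invertible_equiv_closure gcg_invariant_equiv_closure)

end
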